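(* Let $m\geq 2$ be an integer, let $n_1=m(m+1)$, $n_2=m(m+1)+1$, $n_3=(m+1)^2$, $n_4=(m+1)^2+1$, and let $\mathfrak{S}_m=\langle n_1,n_2,n_3,n_4\rangle$ be the numerical semigroup generated by these integers. Then the Apéry set of $\mathfrak{S}_m$ with respect to $n_1$ is $$\mathrm{Ap}(\mathfrak{S}_m,n_1)=\{0\}\cup\mathfrak{A}_1\cup\mathfrak{A}_2\cup\mathfrak{A}_3\cup\mathfrak{A}_4\cup\mathfrak{A}_5,$$ where $\mathfrak{A}_1=\{in_2\mid 1\leq i\leq m\}$, $\mathfrak{A}_2=\{in_3\mid 1\leq i\leq m-1\}$, $\mathfrak{A}_3=\{in_4\mid 1\leq i\leq m-1\}$, $\mathfrak{A}_4=\{in_2+jn_4\mid 1\leq i\leq m-1,\ 1\leq j\leq m-i\}$, $\mathfrak{A}_5=\{in_3+jn_4\mid 1\leq i\leq m-2,\ 1\leq j\leq (m-1)-i\}$.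
   Context: $\langle a_1,\dots,a_e\rangle$ denotes the set of all non-negative integer combinations of $a_1,\dots,a_e$. For a numerical semigroup $\Gamma$ and $0\neq a\in\Gamma$, the Apéry set is $\mathrm{Ap}(\Gamma,a)=\{s\in\Gamma\mid s-a\notin\Gamma\}$. *)

theory Defs
  imports Main
begin

definition generated_semigroup :: "nat list \<Rightarrow> nat set" where
  "generated_semigroup as = {\<Sum>i<length as. c i * as ! i | c :: nat \<Rightarrow> nat. True}"

definition numerical_semigroup :: "nat set \<Rightarrow> bool" where
  "numerical_semigroup S \<longleftrightarrow>
     0 \<in> S \<and> (\<forall>x\<in>S. \<forall>y\<in>S. x + y \<in> S) \<and> finite (- S)"

text \<open>The difference \<open>s - a\<close> is taken in the integers, as it may be negative.\<close>

definition Apery :: "nat set \<Rightarrow> nat \<Rightarrow> nat set" where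
  "Apery S a = {s \<in> S. int s - int a \<notin> int ` S}"

lemma zero_in_generated_semigroup: "0 \<in> generated_semigroup as"
  unfolding generated_semigroup_def by (intro CollectI exI[of _ "\<lambda>_. 0"]) simp

lemma generated_semigroup_add:
  assumes "x \<in> generated_semigroup as" "y \<in> generated_semigroup as"
  shows "x + y \<in> generated_semigroup as"
proof -
  obtain c d :: "nat \<Rightarrow> nat"
    where "x = (\<Sum>i<length as. c i * as ! i)" "y = (\<Sum>i<length as. d i * as ! i)"
    using assms unfolding generated_semigroup_def by auto
  then have "x + y = (\<Sum>i<length as. (c i + d i) * as ! i)"
    by (simp add: sum.distrib add_mult_distrib)
  then show ?thesis
    unfolding generated_semigroup_def by (intro CollectI exI[of _ "\<lambda>i. c i + d i"]) simp
qed

lemma numerical_semigroup_generated: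
  assumes "n > 0"
  shows "numerical_semigroup (generated_semigroup [n, n + 1, a, b])"
proof -
  have "x \<in> generated_semigroup [n, n + 1, a, b]" if "n * n \<le> x" for x
  proof -
    define q r where "q = x div n" and "r = x mod n"
    have x: "x = n * q + r" and r: "r < n"
      using assms by (simp_all add: q_def r_def)
    have "n \<le> q"
      using that assms by (simp add: q_def less_eq_div_iff_mult_less_eq)
    with r have "r \<le> q" by simp
    then obtain k where k: "q = r + k" using le_Suc_ex by blast
    define c :: "nat \<Rightarrow> nat" where "c = (\<lambda>i. if i = 0 then k else if i = 1 then r else 0)"
    have "x = (\<Sum>i<length [n, n + 1, a, b]. c i * [n, n + 1, a, b] ! i)"
      unfolding x k c_def by (simp add: algebra_simps)
    then show ?thesis
      unfolding generated_semigroup_def by blast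
  qed
  then have "- generated_semigroup [n, n + 1, a, b] \<subseteq> {..<n * n}"
    using not_less by auto
  then have "finite (- generated_semigroup [n, n + 1, a, b])"
    using finite_subset by blast
  then show ?thesis
    unfolding numerical_semigroup_def
    using zero_in_generated_semigroup generated_semigroup_add by blast
qed

end

theory Submission
  imports Defs
begin

text \<open>
  Write \<open>N = n1 = m (m + 1)\<close>. Every natural number is uniquely
  \<open>N k + (m + 1) q + t\<close> with \<open>q < m\<close> and \<open>t \<le> m\<close>. The combination
  \<open>a n1 + b n2 + c n3 + d n4\<close> equals
  \<open>N (a + b + c + d) + (m + 1) (c + d) + (b + d)\<close>, and carrying shows that a number lies in the
  semigroup exactly if \<open>max q t \<le> k\<close>. Hence the Apery set consists of the numbers with
  \<open>k = max q t\<close>; such a number is \<open>(q - t) n3 + t n4\<close> if \<open>t \<le> q\<close> and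
  \<open>(t - q) n2 + q n4\<close> if \<open>q \<le> t\<close>.
\<close>

lemma mem_generated_semigroup_4:
  "x \<in> generated_semigroup [n1, n2, n3, n4] \<longleftrightarrow>
    (\<exists>a b c d. x = a * n1 + b * n2 + c * n3 + d * n4)"
proof
  assume "x \<in> generated_semigroup [n1, n2, n3, n4]"
  then obtain c :: "nat \<Rightarrow> nat"
    where "x = (\<Sum>i<length [n1, n2, n3, n4]. c i * [n1, n2, n3, n4] ! i)"
    unfolding generated_semigroup_def by blast
  then have "x = c 0 * n1 + c 1 * n2 + c 2 * n3 + c 3 * n4"
    by (simp add: eval_nat_numeral)
  then show "\<exists>a b c d. x = a * n1 + b * n2 + c * n3 + d * n4"
    by blast
next
  assume "\<exists>a b c d. x = a * n1 + b * n2 + c * n3 + d * n4"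
  then obtain a b c d where x: "x = a * n1 + b * n2 + c * n3 + d * n4"
    by blast
  have "x = (\<Sum>i<length [n1, n2, n3, n4]. [a, b, c, d] ! i * [n1, n2, n3, n4] ! i)"
    by (simp add: x)
  then show "x \<in> generated_semigroup [n1, n2, n3, n4]"
    unfolding generated_semigroup_def by blast
qed

lemma mem_Apery_iff: "x \<in> Apery S a \<longleftrightarrow> x \<in> S \<and> (\<forall>y\<in>S. x \<noteq> y + a)"
  by (force simp: Apery_def image_iff)

text \<open>A mixed-radix numeral with places \<open>1\<close>, \<open>m + 1\<close> and
  \<open>m * (m + 1)\<close>. The bounds on the digits \<open>q\<close> and \<open>t\<close> are not
  built in; they appear as side conditions where needed.\<close>

definition expansion :: "nat \<Rightarrow> nat \<Rightarrow> nat \<Rightarrow> nat \<Rightarrow> nat" where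
  "expansion m k q t = m * (m + 1) * k + (m + 1) * q + t"

lemma expansion_unique:
  assumes "expansion m k q t = expansion m k' q' t'"
    and "q < m" "t \<le> m" "q' < m" "t' \<le> m"
  shows "k = k'" "q = q'" "t = t'"
proof -
  have digits: "t = x mod (m + 1) \<and> q = x div (m + 1) mod m \<and> k = x div (m + 1) div m"
    if x: "x = expansion m k q t" and "q < m" "t \<le> m" for x k q t
  proof -
    have "x = (m + 1) * (m * k + q) + t"
      by (simp add: x expansion_def algebra_simps)
    with \<open>t \<le> m\<close> have "x mod (m + 1) = t" "x div (m + 1) = m * k + q"
      \<comment> \<open>Unfolding the factor \<open>m + 1\<close> would break up the product on
        which the \<open>div\<close> and \<open>mod\<close> rules match.\<close>
      by (simp_all del: mult_Suc add_Suc)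
    with \<open>q < m\<close> show ?thesis by simp
  qed
  show "k = k'" "q = q'" "t = t'"
    using digits[OF refl assms(2,3)] digits[OF assms(1) assms(4,5)] by simp_all
qed

text \<open>As triples \<open>(k, q, t)\<close> the generators n2, n3, n4 are (1,0,1), (1,1,0),
  (1,1,1). So n4 covers the common part of \<open>q\<close> and \<open>t\<close>, and n3 or n2 the
  excess of one over the other.\<close>

lemma expansion_eq_combinations:
  "t \<le> q \<Longrightarrow> expansion m q q t = (q - t) * (m + 1)^2 + t * ((m + 1)^2 + 1)"
  "q \<le> t \<Longrightarrow> expansion m t q t = (t - q) * (m * (m + 1) + 1) + q * ((m + 1)^2 + 1)"
  by (auto simp: expansion_def algebra_simps power2_eq_square dest!: le_Suc_ex)

text \<open>Each generator adds 1 to \<open>k\<close> and at most 1 to \<open>q\<close> and to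
  \<open>t\<close>, and carrying preserves the resulting inequality. Conversely,
  \<open>max q t\<close> generators produce the digits \<open>q\<close> and \<open>t\<close>, and
  copies of n1 fill up \<open>k\<close>.\<close>

lemma generated_semigroup_eq_expansion:
  assumes "m > 0"
  shows "generated_semigroup [m * (m + 1), m * (m + 1) + 1, (m + 1)^2, (m + 1)^2 + 1] =
    {expansion m k q t | k q t. q < m \<and> t \<le> m \<and> max q t \<le> k}" (is "?S = ?T")
proof (intro set_eqI iffI)
  fix x
  assume "x \<in> ?S"
  then obtain a b c d where
    "x = a * (m * (m + 1)) + b * (m * (m + 1) + 1) + c * (m + 1)^2 + d * ((m + 1)^2 + 1)"
    unfolding mem_generated_semigroup_4 by blast
  then have x: "x = m * (m + 1) * (a + b + c + d) + (m + 1) * (c + d) + (b + d)"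
    by (simp add: algebra_simps power2_eq_square)
  \<comment> \<open>\<open>u\<close> is the carry out of the lowest place, \<open>v\<close> the
    carry out of the middle place.\<close>
  define u where "u = (b + d) div (m + 1)"
  define t where "t = (b + d) mod (m + 1)"
  define v where "v = (c + d + u) div m"
  define q where "q = (c + d + u) mod m"
  have bd: "b + d = (m + 1) * u + t" and cd: "c + d + u = m * v + q"
    by (simp_all only: u_def t_def v_def q_def mult_div_mod_eq)
  have "x = m * (m + 1) * (a + b + c + d) + (m + 1) * (c + d + u) + t"
    unfolding x bd by (simp add: algebra_simps)
  then have "x = expansion m (a + b + c + d + v) q t"
    unfolding cd expansion_def by (simp add: algebra_simps)
  moreover have q: "q < m" and "t \<le> m"
    using assms by (simp_all add: q_def t_def less_Suc_eq_le[symmetric])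
  moreover have "t \<le> b + d"
    by (simp add: bd)
  \<comment> \<open>The carry \<open>u\<close> could push \<open>q\<close> above
    \<open>c + d\<close>, but a nonzero carry forces \<open>b + d\<close> to be at least
    \<open>m + 1\<close>, which exceeds \<open>q\<close>. Both sums are at most the new leading
    coefficient.\<close>
  moreover have "q \<le> max (c + d) (b + d)"
  proof (cases "u = 0")
    case True
    with cd show ?thesis by simp
  next
    case False
    have "q \<le> (m + 1) * 1" using q by simp
    also have "\<dots> \<le> (m + 1) * u" using False by (intro mult_le_mono2) simp
    also have "\<dots> \<le> b + d" unfolding bd by (rule le_add1)
    finally have "q \<le> b + d" .
    then show ?thesis by simp
  qed
  ultimately show "x \<in> ?T" by fastforce
next
  fix x
  assume "x \<in> ?T"
  then obtain k q t where x: "x = expansion m k q t" and k: "max q t \<le> k"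
    by blast
  have "x = (k - max q t) * (m * (m + 1)) + expansion m (max q t) q t"
  proof -
    from k obtain l where "k = max q t + l"
      using le_Suc_ex by blast
    then show ?thesis
      unfolding x by (simp add: expansion_def algebra_simps)
  qed
  \<comment> \<open>Truncated subtraction merges the two cases: at least one of \<open>t - q\<close>
    and \<open>q - t\<close> is 0.\<close>
  also have "expansion m (max q t) q t =
      (t - q) * (m * (m + 1) + 1) + (q - t) * (m + 1)^2 + min q t * ((m + 1)^2 + 1)"
    using expansion_eq_combinations[of t q m] expansion_eq_combinations[of q t m]
    by (cases "t \<le> q") (simp_all add: max_def min_def)
  finally show "x \<in> ?S"
    unfolding mem_generated_semigroup_4 by (metis add.assoc)
qed

text \<open>Adding n1 raises \<open>k\<close> by one and leaves \<open>q\<close> and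
  \<open>t\<close> alone, so subtracting it leaves the semigroup exactly when \<open>k\<close> is
  already minimal.\<close>

lemma Apery_eq_expansion:
  assumes "m > 0"
  shows "Apery (generated_semigroup
      [m * (m + 1), m * (m + 1) + 1, (m + 1)^2, (m + 1)^2 + 1]) (m * (m + 1)) =
    {expansion m (max q t) q t | q t. q < m \<and> t \<le> m}" (is "Apery ?S ?n = ?A")
proof (intro set_eqI iffI)
  fix x
  assume "x \<in> Apery ?S ?n"
  then have "x \<in> ?S" and x: "\<And>y. y \<in> ?S \<Longrightarrow> x \<noteq> y + ?n"
    unfolding mem_Apery_iff by blast+
  then obtain k q t where kqt: "x = expansion m k q t" "q < m" "t \<le> m" "max q t \<le> k"
    unfolding generated_semigroup_eq_expansion[OF assms] by blast
  have "k = max q t"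
  proof (rule ccontr)
    assume "k \<noteq> max q t"
    with kqt obtain l where l: "k = Suc l" "max q t \<le> l"
      by (intro that[of "k - 1"]) auto
    then have "expansion m l q t \<in> ?S"
      unfolding generated_semigroup_eq_expansion[OF assms] using kqt by blast
    moreover have "x = expansion m l q t + ?n"
      by (simp add: kqt l expansion_def algebra_simps)
    ultimately show False
      using x by blast
  qed
  with kqt show "x \<in> ?A" by blast
next
  fix x
  assume "x \<in> ?A"
  then obtain q t where qt: "x = expansion m (max q t) q t" "q < m" "t \<le> m"
    by blast
  have "x \<noteq> y + ?n" if "y \<in> ?S" for y
  proof
    assume "x = y + ?n"
    from that obtain k q' t' where
      y: "y = expansion m k q' t'" "q' < m" "t' \<le> m" "max q' t' \<le> k"
      unfolding generated_semigroup_eq_expansion[OF assms] by blast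
    with \<open>x = y + ?n\<close> have "expansion m (max q t) q t = expansion m (Suc k) q' t'"
      unfolding qt(1) by (simp add: expansion_def algebra_simps)
    \<comment> \<open>Equal digits give \<open>Suc k = max q' t'\<close>, against
      \<open>max q' t' \<le> k\<close>.\<close>
    from expansion_unique[OF this qt(2,3) y(2,3)] y(4) show False
      by simp
  qed
  moreover have "x \<in> ?S"
    unfolding generated_semigroup_eq_expansion[OF assms] using qt by blast
  ultimately show "x \<in> Apery ?S ?n"
    unfolding mem_Apery_iff by blast
qed

theorem theorem4p1:
  fixes m n1 n2 n3 n4 :: nat
  assumes "m \<ge> 2"
    and "n1 = m * (m + 1)"
    and "n2 = m * (m + 1) + 1"
    and "n3 = (m + 1)^2"
    and "n4 = (m + 1)^2 + 1"
  shows "Apery (generated_semigroup [n1, n2, n3, n4]) n1 =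
    {0}
    \<union> {i * n2 | i. 1 \<le> i \<and> i \<le> m}
    \<union> {i * n3 | i. 1 \<le> i \<and> i \<le> m - 1}
    \<union> {i * n4 | i. 1 \<le> i \<and> i \<le> m - 1}
    \<union> {i * n2 + j * n4 | i j. 1 \<le> i \<and> i \<le> m - 1 \<and> 1 \<le> j \<and> j \<le> m - i}
    \<union> {i * n3 + j * n4 | i j. 1 \<le> i \<and> i \<le> m - 2 \<and> 1 \<le> j \<and> j \<le> (m - 1) - i}"
    (is "_ = ?R")
proof -
  have low: "expansion m (max q t) q t = (q - t) * n3 + t * n4" if "t \<le> q" for q t
    using expansion_eq_combinations(1)[OF that] that assms by (simp add: max_def)
  have high: "expansion m (max q t) q t = (t - q) * n2 + q * n4" if "q \<le> t" for q t
    using expansion_eq_combinations(2)[OF that] that assms by (simp add: max_def)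
  let ?A = "{expansion m (max q t) q t | q t. q < m \<and> t \<le> m}"
  \<comment> \<open>The digits are \<open>q = i + j\<close> and \<open>t = j\<close>, so the strict
    bound on \<open>q\<close> limits the sum.\<close>
  have n3n4: "i * n3 + j * n4 \<in> ?A" if "i + j < m" for i j
  proof -
    have "i * n3 + j * n4 = expansion m (max (i + j) j) (i + j) j" "j \<le> m"
      using low[of j "i + j"] that by simp_all
    with that show ?thesis by blast
  qed
  \<comment> \<open>Now \<open>q = j\<close> and \<open>t = i + j\<close>. Since \<open>t\<close>
    may equal \<open>m\<close>, multiples of n2 reach one step further than those of n3 and
    n4.\<close>
  have n2n4: "i * n2 + j * n4 \<in> ?A" if "j < m" "i + j \<le> m" for i j
  proof -
    have "i * n2 + j * n4 = expansion m (max j (i + j)) j (i + j)"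
      using high[of j "i + j"] by simp
    with that show ?thesis by blast
  qed
  have "?A = ?R"
  proof (intro set_eqI iffI)
    fix x
    assume "x \<in> ?A"
    then obtain q t where x: "x = expansion m (max q t) q t" and qt: "q < m" "t \<le> m"
      by blast
    \<comment> \<open>The six cases correspond, in order, to the six sets of the union.\<close>
    consider "q = 0" "t = 0" | "q = 0" "0 < t" | "t = 0" "0 < q" | "0 < q" "q = t"
      | "0 < q" "q < t" | "0 < t" "t < q"
      by linarith
    then show "x \<in> ?R"
    proof cases
      case 1
      then show ?thesis by (simp add: x expansion_def)
    next
      case 2
      then have "x = t * n2" "1 \<le> t" using high[of 0 t] by (simp_all add: x)
      with qt show ?thesis by blast
    next
      case 3
      then have "x = q * n3" "1 \<le> q" "q \<le> m - 1" using qt low[of 0 q] by (simp_all add: x)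
      then show ?thesis by blast
    next
      case 4
      then have "x = q * n4" "1 \<le> q" "q \<le> m - 1" using qt low[of q q] by (simp_all add: x)
      then show ?thesis by blast
    next
      case 5
      then have "x = (t - q) * n2 + q * n4" "1 \<le> t - q" "t - q \<le> m - 1" "1 \<le> q" "q \<le> m - (t - q)"
        using qt high[of q t] by (simp_all add: x)
      then show ?thesis by blast
    next
      case 6
      then have "x = (q - t) * n3 + t * n4" "1 \<le> q - t" "q - t \<le> m - 2" "1 \<le> t"
        "t \<le> (m - 1) - (q - t)"
        using qt low[of t q] by (simp_all add: x)
      then show ?thesis by blast
    qed
  next
    fix x
    assume "x \<in> ?R"
    then consider "x = 0" | i where "x = i * n2" "i \<le> m" | i where "x = i * n3" "1 \<le> i" "i \<le> m - 1"
      | i where "x = i * n4" "1 \<le> i" "i \<le> m - 1"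
      | i j where "x = i * n2 + j * n4" "1 \<le> i" "i \<le> m - 1" "1 \<le> j" "j \<le> m - i"
      | i j where "x = i * n3 + j * n4" "1 \<le> i" "i \<le> m - 2" "1 \<le> j" "j \<le> (m - 1) - i"
      by blast
    then show "x \<in> ?A"
    proof cases
      case 1
      then show ?thesis using n3n4[of 0 0] assms(1) by simp
    next
      case 2
      then show ?thesis using n2n4[of 0 i] assms(1) by simp
    next
      case 3
      then have "i + 0 < m" by linarith
      from n3n4[OF this] 3 show ?thesis by simp
    next
      case 4
      then have "0 + i < m" by linarith
      from n3n4[OF this] 4 show ?thesis by simp
    next
      case 5
      \<comment> \<open>From \<open>1 \<le> i\<close> and \<open>j \<le> m - i\<close> the digit
        \<open>q = j\<close> stays strictly below \<open>m\<close>.\<close>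
      then have "j < m" "i + j \<le> m" by linarith+
      from n2n4[OF this] 5 show ?thesis by simp
    next
      case 6
      then have "i + j < m" by linarith
      from n3n4[OF this] 6 show ?thesis by simp
    qed
  qed
  with Apery_eq_expansion[of m] assms show ?thesis by simp
qed

end
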